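(* Let $n$ be a positive integer $\geq 2$. The subset of idempotents $E(\mathcal{PO}_{\infty}(\mathbb{N}^n_{\leqslant}))$ of the semigroup $\mathcal{PO}_{\infty}(\mathbb{N}^n_{\leqslant})$ is a commutative submonoid of $\mathcal{PO}_{\infty}(\mathbb{N}^n_{\leqslant})$, and moreover $E(\mathcal{PO}_{\infty}(\mathbb{N}^n_{\leqslant}))$ is isomorphic to the free semilattice with unit $(\mathcal{P}^*(\mathbb{N}^n),\cup)$ over the set $\mathbb{N}^n$ under the map $(\varepsilon)\mathfrak{h}=\mathbb{N}^n\setminus\operatorname{dom}\varepsilon$.
   Context: $\mathbb{N}$ is the set of positive integers, and $\mathbb{N}^n_{\leqslant}$ is the set $\mathbb{N}^n$ with the product order: $(i_1,\ldots,i_n)\leqslant(j_1,\ldots,j_n)$ iff $i_k\le j_k$ for all $k$. A partial map $\alpha$ of a poset is monotone if $x\leqslant y$ implies $(x)\alpha\leqslant(y)\alpha$ for all $x,y\in\operatorname{dom}\alpha$. Maps are written on the right, and partial maps are composed by $(x)(\alpha\beta)=((x)\alpha)\beta$ with $\operatorname{dom}(\alpha\beta)=\{y\in\operatorname{dom}\alpha: (y)\alpha\in\operatorname{dom}\beta\}$. $\mathcal{PO}_{\infty}(\mathbb{N}^n_{\leqslant})$ is the semigroup, under this composition, of all injective monotone partial selfmaps $\alpha$ of $\mathbb{N}^n_{\leqslant}$ such that $\mathbb{N}^n\setminus\operatorname{dom}\alpha$ and $\mathbb{N}^n\setminus\operatorname{ran}\alpha$ are finite; its identity is the identity map of $\mathbb{N}^n$.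 $E(S)$ denotes the set of idempotents of a semigroup $S$. $\mathcal{P}^*(\mathbb{N}^n)$ denotes the family of all finite subsets of $\mathbb{N}^n$ (including the empty set, which is the unit), with the operation of union. *)

theory Defs
  imports "HOL-Algebra.Group"
begin

definition pos_tuples :: "nat \<Rightarrow> (nat \<Rightarrow> nat) set" where
  "pos_tuples n = {1..n} \<rightarrow>\<^sub>E {1..}"

definition tuple_le :: "nat \<Rightarrow> (nat \<Rightarrow> nat) \<Rightarrow> (nat \<Rightarrow> nat) \<Rightarrow> bool" where
  "tuple_le n x y \<longleftrightarrow> (\<forall>k\<in>{1..n}. x k \<le> y k)"

definition monotone_partial :: "nat \<Rightarrow> ((nat \<Rightarrow> nat) \<rightharpoonup> (nat \<Rightarrow> nat)) \<Rightarrow> bool" where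
  "monotone_partial n \<alpha> \<longleftrightarrow>
     monotone_on (dom \<alpha>) (tuple_le n) (tuple_le n) (\<lambda>x. the (\<alpha> x))"

text \<open>Maps are written on the right, so the product \<open>\<alpha>\<beta>\<close> applies \<open>\<alpha>\<close> first.\<close>

definition PO_inf :: "nat \<Rightarrow> ((nat \<Rightarrow> nat) \<rightharpoonup> (nat \<Rightarrow> nat)) monoid" where
  "PO_inf n =
     \<lparr>carrier = {\<alpha>. dom \<alpha> \<subseteq> pos_tuples n \<and> ran \<alpha> \<subseteq> pos_tuples n \<and>
                    inj_on \<alpha> (dom \<alpha>) \<and> monotone_partial n \<alpha> \<and>
                    finite (pos_tuples n - dom \<alpha>) \<and> finite (pos_tuples n - ran \<alpha>)},
      monoid.mult = (\<lambda>\<alpha> \<beta>. \<beta> \<circ>\<^sub>m \<alpha>),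
      one = (\<lambda>x. if x \<in> pos_tuples n then Some x else None)\<rparr>"

lemma PO_inf_mult_closed:
  assumes "\<alpha> \<in> carrier (PO_inf n)" "\<beta> \<in> carrier (PO_inf n)"
  shows "\<alpha> \<otimes>\<^bsub>PO_inf n\<^esub> \<beta> \<in> carrier (PO_inf n)"
proof -
  let ?N = "pos_tuples n" and ?g = "\<beta> \<circ>\<^sub>m \<alpha>"
  have a: "dom \<alpha> \<subseteq> ?N" "ran \<alpha> \<subseteq> ?N" "inj_on \<alpha> (dom \<alpha>)" "monotone_partial n \<alpha>"
      "finite (?N - dom \<alpha>)" "finite (?N - ran \<alpha>)"
    and b: "dom \<beta> \<subseteq> ?N" "ran \<beta> \<subseteq> ?N" "inj_on \<beta> (dom \<beta>)" "monotone_partial n \<beta>"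
      "finite (?N - dom \<beta>)" "finite (?N - ran \<beta>)"
    using assms by (auto simp: PO_inf_def)
  have val: "\<exists>y z. \<alpha> x = Some y \<and> \<beta> y = Some z \<and> ?g x = Some z" if "x \<in> dom ?g" for x
    using that by (auto simp: map_comp_def split: option.splits)
  have "dom ?g \<subseteq> ?N" using a(1) val by blast
  moreover have "ran ?g \<subseteq> ?N"
    using b(2) by (auto simp: ran_def map_comp_def split: option.splits)
  moreover have "inj_on ?g (dom ?g)"
  proof (rule inj_onI)
    fix x x' assume x: "x \<in> dom ?g" "x' \<in> dom ?g" and eq: "?g x = ?g x'"
    obtain y z y' z' where 1: "\<alpha> x = Some y" "\<beta> y = Some z" "?g x = Some z"
        "\<alpha> x' = Some y'" "\<beta> y' = Some z'" "?g x' = Some z'"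
      using val[OF x(1)] val[OF x(2)] by blast
    have "y = y'" using inj_onD[OF b(3), of y y'] 1 eq by (simp add: domIff)
    then show "x = x'" using inj_onD[OF a(3), of x x'] 1 by (simp add: domIff)
  qed
  moreover have "monotone_partial n ?g"
    unfolding monotone_partial_def
  proof (rule monotone_onI)
    fix x x' assume x: "x \<in> dom ?g" "x' \<in> dom ?g" and le: "tuple_le n x x'"
    obtain y z y' z' where 1: "\<alpha> x = Some y" "\<beta> y = Some z" "?g x = Some z"
        "\<alpha> x' = Some y'" "\<beta> y' = Some z'" "?g x' = Some z'"
      using val[OF x(1)] val[OF x(2)] by blast
    have "tuple_le n y y'"
      using monotone_onD[OF a(4)[unfolded monotone_partial_def], of x x'] 1 le by auto
    then show "tuple_le n (the (?g x)) (the (?g x'))"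
      using monotone_onD[OF b(4)[unfolded monotone_partial_def], of y y'] 1 by auto
  qed
  moreover have "finite (?N - dom ?g)"
  proof -
    let ?B = "{x \<in> dom \<alpha>. the (\<alpha> x) \<in> ?N - dom \<beta>}"
    have "inj_on (\<lambda>x. the (\<alpha> x)) ?B"
    proof (rule inj_onI)
      fix x x' assume "x \<in> ?B" "x' \<in> ?B" "the (\<alpha> x) = the (\<alpha> x')"
      then show "x = x'" using inj_onD[OF a(3), of x x'] by auto
    qed
    moreover have "(\<lambda>x. the (\<alpha> x)) ` ?B \<subseteq> ?N - dom \<beta>" by auto
    ultimately have "finite ?B" using b(5) by (meson finite_imageD finite_subset)
    moreover have "?N - dom ?g \<subseteq> (?N - dom \<alpha>) \<union> ?B"
    proof
      fix x assume x: "x \<in> ?N - dom ?g"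
      show "x \<in> (?N - dom \<alpha>) \<union> ?B"
      proof (cases "\<alpha> x")
        case (Some y)
        then have "y \<in> ?N" by (rule subsetD[OF a(2) ranI])
        moreover have "\<beta> y = None" using x Some by (simp add: domIff)
        ultimately show ?thesis using Some by (simp add: domIff)
      qed (use x in \<open>simp add: domIff\<close>)
    qed
    ultimately show ?thesis using a(5) by (meson finite_UnI finite_subset)
  qed
  moreover have "finite (?N - ran ?g)"
  proof -
    have "?N - ran ?g \<subseteq> (?N - ran \<beta>) \<union> (\<lambda>y. the (\<beta> y)) ` (?N - ran \<alpha>)"
    proof
      fix z assume z: "z \<in> ?N - ran ?g"
      show "z \<in> (?N - ran \<beta>) \<union> (\<lambda>y. the (\<beta> y)) ` (?N - ran \<alpha>)"
      proof (cases "z \<in> ran \<beta>")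
        case True
        then obtain y where y: "\<beta> y = Some z" by (auto simp: ran_def)
        have "y \<notin> ran \<alpha>"
        proof
          assume "y \<in> ran \<alpha>"
          then obtain x where "\<alpha> x = Some y" by (auto simp: ran_def)
          then have "?g x = Some z" using y by simp
          then show False using z by (auto simp: ran_def)
        qed
        moreover have "y \<in> ?N" using b(1) y by auto
        moreover have "z = the (\<beta> y)" using y by simp
        ultimately show ?thesis by blast
      qed (use z in auto)
    qed
    then show ?thesis using a(6) b(6) by (meson finite_UnI finite_imageI finite_subset)
  qed
  ultimately show ?thesis by (simp add: PO_inf_def)
qed

lemma PO_inf_one_closed: "\<one>\<^bsub>PO_inf n\<^esub> \<in> carrier (PO_inf n)"
proof -
  let ?i = "\<lambda>x. if x \<in> pos_tuples n then Some x else None"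
  have "dom ?i = pos_tuples n" "ran ?i = pos_tuples n"
    by (auto simp: dom_def ran_def split: if_splits)
  then show ?thesis
    by (auto simp: PO_inf_def monotone_partial_def intro!: inj_onI monotone_onI)
qed

lemma monoid_PO_inf: "monoid (PO_inf n)"
proof
  fix \<alpha> \<beta> \<gamma>
  assume a: "\<alpha> \<in> carrier (PO_inf n)"
  show "\<alpha> \<otimes>\<^bsub>PO_inf n\<^esub> \<beta> \<otimes>\<^bsub>PO_inf n\<^esub> \<gamma> = \<alpha> \<otimes>\<^bsub>PO_inf n\<^esub> (\<beta> \<otimes>\<^bsub>PO_inf n\<^esub> \<gamma>)"
    by (simp add: PO_inf_def map_comp_def fun_eq_iff split: option.split)
  have dr: "dom \<alpha> \<subseteq> pos_tuples n" "ran \<alpha> \<subseteq> pos_tuples n"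
    using a by (simp_all add: PO_inf_def)
  show "\<one>\<^bsub>PO_inf n\<^esub> \<otimes>\<^bsub>PO_inf n\<^esub> \<alpha> = \<alpha>"
  proof
    fix x
    show "(\<one>\<^bsub>PO_inf n\<^esub> \<otimes>\<^bsub>PO_inf n\<^esub> \<alpha>) x = \<alpha> x"
    proof (cases "x \<in> pos_tuples n")
      case False
      then have "\<alpha> x = None" using dr(1) by blast
      with False show ?thesis by (simp add: PO_inf_def map_comp_def)
    qed (simp add: PO_inf_def map_comp_def)
  qed
  show "\<alpha> \<otimes>\<^bsub>PO_inf n\<^esub> \<one>\<^bsub>PO_inf n\<^esub> = \<alpha>"
  proof
    fix x
    show "(\<alpha> \<otimes>\<^bsub>PO_inf n\<^esub> \<one>\<^bsub>PO_inf n\<^esub>) x = \<alpha> x"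
    proof (cases "\<alpha> x")
      case (Some y)
      then have "y \<in> pos_tuples n" by (intro subsetD[OF dr(2) ranI])
      with Some show ?thesis by (simp add: PO_inf_def map_comp_def)
    qed (simp add: PO_inf_def map_comp_def)
  qed
qed (auto intro: PO_inf_mult_closed PO_inf_one_closed)

definition idempotents :: "('a, 'm) monoid_scheme \<Rightarrow> 'a set" where
  "idempotents S = {e \<in> carrier S. e \<otimes>\<^bsub>S\<^esub> e = e}"

definition finite_subsets :: "'a set \<Rightarrow> 'a set monoid" where
  "finite_subsets X = \<lparr>carrier = Fpow X, monoid.mult = (\<union>), one = {}\<rparr>"

definition semilattice_with_unit :: "('a, 'm) monoid_scheme \<Rightarrow> bool" where
  "semilattice_with_unit M \<longleftrightarrow> comm_monoid M \<and> (\<forall>x\<in>carrier M. x \<otimes>\<^bsub>M\<^esub> x = x)"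

text \<open>
  The universal property of \<open>F\<close> as the free semilattice with unit over \<open>X\<close>, with \<open>\<iota>\<close> the insertion
  of generators. HOL cannot quantify over types inside a formula, so the element type \<open>'b\<close> of the
  target semilattices is a parameter; leaving it a type variable in a theorem covers every type.
  Preservation of the unit is required separately because \<^const>\<open>hom\<close> does not include it, and
  uniqueness is meant up to values outside the carrier, hence \<^const>\<open>extensional\<close>.
\<close>

definition free_semilattice_with_unit ::
    "'b itself \<Rightarrow> 'a set \<Rightarrow> ('a \<Rightarrow> 'c) \<Rightarrow> ('c, 'm) monoid_scheme \<Rightarrow> bool" where
  "free_semilattice_with_unit _ X \<iota> F \<longleftrightarrow>
     semilattice_with_unit F \<and> \<iota> \<in> X \<rightarrow> carrier F \<and>
     (\<forall>(M :: 'b monoid) f. semilattice_with_unit M \<longrightarrow> f \<in> X \<rightarrow> carrier M \<longrightarrow>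
        (\<exists>!h. h \<in> extensional (carrier F) \<and> h \<in> hom F M \<and> h \<one>\<^bsub>F\<^esub> = \<one>\<^bsub>M\<^esub> \<and>
              (\<forall>x\<in>X. h (\<iota> x) = f x)))"

end

theory Submission
  imports Defs "HOL-Algebra.FiniteProduct"
begin

text \<open>
  An injective partial map \<open>\<epsilon>\<close> with \<open>\<epsilon> \<epsilon> = \<epsilon>\<close> is a partial identity: if \<open>\<epsilon>\<close> sends \<open>x\<close> to \<open>y\<close>,
  then it also sends \<open>y\<close> to \<open>y\<close>, and injectivity forces \<open>x = y\<close>. Conversely every partial identity
  with cofinite domain is injective and monotone with cofinite range, and it is idempotent. So the
  idempotents of \<open>\<P>\<O>\<^sub>\<infinity>(\<nat>\<^sup>n)\<close> correspond to the cofinite subsets of \<open>\<nat>\<^sup>n\<close>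
  (lemma \<open>idempotents_PO_inf\<close>). Composing partial identities intersects their domains, so the
  complements of the domains, which are finite, are joined: this gives commutativity and the
  isomorphism with the finite subsets under union.

  That the finite subsets of any set \<open>X\<close> form the free semilattice with unit over \<open>X\<close> is a statement
  about finite products: in a semilattice a repeated factor is absorbed, so the product of a family
  over a finite set turns unions into products, also when the sets overlap
  (lemma \<open>finprod_Un_of_idempotent\<close>). This product extends \<open>f\<close> from the generators, and it is the
  only extension because every finite set is a finite union of singletons.
\<close>

section \<open>Finite subsets as the free semilattice with unit\<close>

lemma semilattice_with_unit_finite_subsets: "semilattice_with_unit (finite_subsets X)"
  unfolding semilattice_with_unit_def
proof (intro conjI ballI)
  show "comm_monoid (finite_subsets X)"
    by (rule comm_monoidI) (auto simp: finite_subsets_def Fpow_def)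
qed (auto simp: finite_subsets_def)

lemma (in comm_monoid) finprod_insert_of_idempotent:
  assumes idem: "f x \<otimes> f x = f x"
    and "finite A" and f: "f \<in> insert x A \<rightarrow> carrier G"
  shows "finprod G f (insert x A) = f x \<otimes> finprod G f A"
proof (cases "x \<in> A")
  case True
  then have A: "insert x (A - {x}) = A" by blast
  have cl: "f x \<in> carrier G" "f \<in> A - {x} \<rightarrow> carrier G" using f by auto
  have "finprod G f A = f x \<otimes> finprod G f (A - {x})"
    using finprod_insert[of "A - {x}" x f] \<open>finite A\<close> cl A by simp
  moreover have "f x \<otimes> (f x \<otimes> finprod G f (A - {x})) = f x \<otimes> finprod G f (A - {x})"
    using m_assoc[of "f x" "f x" "finprod G f (A - {x})"] cl idem by simp
  ultimately show ?thesis using True by (simp add: insert_absorb)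
next
  case False
  then show ?thesis using finprod_insert[of A x f] assms by auto
qed

text \<open>
  For overlapping sets a factor \<open>f x\<close> with \<open>x \<in> A \<inter> B\<close> occurs once on the left and twice on the
  right; idempotency absorbs the second copy.
\<close>

lemma (in comm_monoid) finprod_Un_of_idempotent:
  assumes idem: "\<And>x. x \<in> A \<Longrightarrow> f x \<otimes> f x = f x"
    and "finite A" "finite B" and "f \<in> A \<union> B \<rightarrow> carrier G"
  shows "finprod G f (A \<union> B) = finprod G f A \<otimes> finprod G f B"
  using \<open>finite A\<close> assms(1,4)
proof (induction A)
  case empty
  then show ?case by simp
next
  case (insert x A)
  have cl: "f x \<in> carrier G" "f \<in> A \<rightarrow> carrier G" "f \<in> B \<rightarrow> carrier G"
    using insert.prems(2) by auto
  have "finprod G f (insert x A \<union> B) = f x \<otimes> finprod G f (A \<union> B)"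
    using finprod_insert_of_idempotent[of f x "A \<union> B"] insert \<open>finite B\<close> by simp
  also have "\<dots> = f x \<otimes> (finprod G f A \<otimes> finprod G f B)"
    using insert.IH insert.prems by simp
  also have "\<dots> = finprod G f (insert x A) \<otimes> finprod G f B"
    using insert.hyps cl by (simp add: m_assoc)
  finally show ?case .
qed

text \<open>
  Uniqueness in the universal property: the singletons together with the unit generate the finite
  subsets. The value at the empty set is a separate premise since \<^const>\<open>hom\<close> only guarantees that
  it is an idempotent of \<open>M\<close>.
\<close>

lemma hom_finite_subsets_eqI:
  assumes g: "g \<in> hom (finite_subsets X) M" and h: "h \<in> hom (finite_subsets X) M"
    and "g {} = h {}" and gen: "\<And>x. x \<in> X \<Longrightarrow> g {x} = h {x}"
    and "A \<in> Fpow X"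
  shows "g A = h A"
proof -
  have "finite A" "A \<subseteq> X" using \<open>A \<in> Fpow X\<close> by (auto simp: Fpow_def)
  then show ?thesis
  proof (induction A)
    case empty
    then show ?case using \<open>g {} = h {}\<close> by simp
  next
    case (insert x A)
    have A: "{x} \<in> Fpow X" "A \<in> Fpow X" using insert by (auto simp: Fpow_def)
    have split: "k (insert x A) = k {x} \<otimes>\<^bsub>M\<^esub> k A" if "k \<in> hom (finite_subsets X) M" for k
      using hom_mult[OF that, of "{x}" A] A by (simp add: finite_subsets_def)
    show ?case using split[OF g] split[OF h] gen[of x] insert by simp
  qed
qed

lemma free_semilattice_with_unit_finite_subsets:
  "free_semilattice_with_unit TYPE('b) X (\<lambda>x. {x}) (finite_subsets X)"
  unfolding free_semilattice_with_unit_def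
proof (intro conjI allI impI)
  show "semilattice_with_unit (finite_subsets X)"
    by (rule semilattice_with_unit_finite_subsets)
  show "(\<lambda>x. {x}) \<in> X \<rightarrow> carrier (finite_subsets X)"
    by (auto simp: finite_subsets_def Fpow_def)
next
  fix M :: "'b monoid" and f
  assume M: "semilattice_with_unit M" and f: "f \<in> X \<rightarrow> carrier M"
  interpret M: comm_monoid M using M by (simp add: semilattice_with_unit_def)
  have idem: "f x \<otimes>\<^bsub>M\<^esub> f x = f x" if "x \<in> X" for x
    using M f that by (auto simp: semilattice_with_unit_def)
  have cl: "f \<in> A \<rightarrow> carrier M" if "A \<in> Fpow X" for A
    using f that by (auto simp: Fpow_def)
  let ?F = "finite_subsets X" and ?h = "restrict (finprod M f) (Fpow X)"
  have Un: "finprod M f (A \<union> B) = finprod M f A \<otimes>\<^bsub>M\<^esub> finprod M f B"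
    if "A \<in> Fpow X" "B \<in> Fpow X" for A B
    using that f by (intro M.finprod_Un_of_idempotent idem) (auto simp: Fpow_def)
  have h: "?h \<in> extensional (carrier ?F)" "?h \<in> hom ?F M" "?h {} = \<one>\<^bsub>M\<^esub>"
    "\<forall>x\<in>X. ?h {x} = f x"
  proof -
    show "?h \<in> extensional (carrier ?F)" by (simp add: finite_subsets_def)
    have "A \<union> B \<in> Fpow X" if "A \<in> Fpow X" "B \<in> Fpow X" for A B
      using that by (auto simp: Fpow_def)
    then show "?h \<in> hom ?F M"
      using cl Un by (intro homI) (auto simp: finite_subsets_def)
    show "?h {} = \<one>\<^bsub>M\<^esub>" by (simp add: Fpow_def)
    show "\<forall>x\<in>X. ?h {x} = f x"
      using f by (auto simp: Fpow_def Pi_iff)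
  qed
  show "\<exists>!h. h \<in> extensional (carrier ?F) \<and> h \<in> hom ?F M \<and> h \<one>\<^bsub>?F\<^esub> = \<one>\<^bsub>M\<^esub> \<and>
          (\<forall>x\<in>X. h {x} = f x)"
  proof (rule ex1I[of _ ?h])
    show "?h \<in> extensional (carrier ?F) \<and> ?h \<in> hom ?F M \<and> ?h \<one>\<^bsub>?F\<^esub> = \<one>\<^bsub>M\<^esub> \<and>
            (\<forall>x\<in>X. ?h {x} = f x)"
      using h by (simp add: finite_subsets_def)
  next
    fix g
    assume g: "g \<in> extensional (carrier ?F) \<and> g \<in> hom ?F M \<and> g \<one>\<^bsub>?F\<^esub> = \<one>\<^bsub>M\<^esub> \<and>
                 (\<forall>x\<in>X. g {x} = f x)"
    show "g = ?h"
    proof (rule extensionalityI)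
      show "g \<in> extensional (carrier ?F)" "?h \<in> extensional (carrier ?F)"
        using g h(1) by simp_all
      fix A assume "A \<in> carrier ?F"
      then have A: "A \<in> Fpow X" by (simp add: finite_subsets_def)
      show "g A = ?h A"
      proof (rule hom_finite_subsets_eqI[OF _ h(2) _ _ A])
        show "g {} = ?h {}" using g h(3) by (simp add: finite_subsets_def)
        show "g {x} = ?h {x}" if "x \<in> X" for x using g h(4) that by simp
      qed (use g in simp)
    qed
  qed
qed

section \<open>Idempotents are partial identities\<close>

text \<open>The partial identity on \<open>A\<close> is written \<open>Some |` A\<close>.\<close>

lemma dom_partial_identity: "dom (Some |` A) = A"
  by (simp add: dom_def restrict_map_def)

lemma ran_partial_identity: "ran (Some |` A) = A"
  by (auto simp: ran_def restrict_map_def)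

lemma comp_partial_identities: "(Some |` A) \<circ>\<^sub>m (Some |` B) = Some |` (A \<inter> B)"
  by (auto simp: map_comp_def restrict_map_def)

lemma mult_PO_inf: "\<alpha> \<otimes>\<^bsub>PO_inf n\<^esub> \<beta> = \<beta> \<circ>\<^sub>m \<alpha>"
  by (simp add: PO_inf_def)

lemma one_PO_inf: "\<one>\<^bsub>PO_inf n\<^esub> = Some |` pos_tuples n"
  by (simp add: PO_inf_def restrict_map_def)

lemma partial_identity_in_PO_inf:
  assumes "A \<subseteq> pos_tuples n" "finite (pos_tuples n - A)"
  shows "Some |` A \<in> carrier (PO_inf n)"
  using assms
  by (auto simp: PO_inf_def dom_partial_identity ran_partial_identity monotone_partial_def
      intro!: inj_onI monotone_onI)

text \<open>
  Both \<open>x\<close> and its image \<open>y\<close> are sent to \<open>y\<close>, so they coincide by injectivity.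
\<close>

lemma partial_identity_of_idempotent:
  assumes inj: "inj_on \<epsilon> (dom \<epsilon>)" and idem: "\<epsilon> \<circ>\<^sub>m \<epsilon> = \<epsilon>"
  shows "\<epsilon> = Some |` dom \<epsilon>"
proof
  fix x
  show "\<epsilon> x = (Some |` dom \<epsilon>) x"
  proof (cases "\<epsilon> x")
    case (Some y)
    then have "\<epsilon> y = Some y" using fun_cong[OF idem, of x] by simp
    then have "x = y" using inj_onD[OF inj, of x y] Some by auto
    then show ?thesis using Some by (simp add: domIff)
  qed (simp add: restrict_map_def domIff)
qed

lemma idempotents_PO_inf:
  "idempotents (PO_inf n) = {Some |` A | A. A \<subseteq> pos_tuples n \<and> finite (pos_tuples n - A)}"
proof (intro equalityI subsetI)
  fix \<epsilon> assume "\<epsilon> \<in> idempotents (PO_inf n)"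
  then have "\<epsilon> = Some |` dom \<epsilon>" "dom \<epsilon> \<subseteq> pos_tuples n" "finite (pos_tuples n - dom \<epsilon>)"
    using partial_identity_of_idempotent[of \<epsilon>] by (auto simp: idempotents_def PO_inf_def)
  then show "\<epsilon> \<in> {Some |` A | A. A \<subseteq> pos_tuples n \<and> finite (pos_tuples n - A)}" by blast
qed (auto simp: idempotents_def mult_PO_inf comp_partial_identities partial_identity_in_PO_inf)

lemma submonoid_idempotents_PO_inf: "submonoid (idempotents (PO_inf n)) (PO_inf n)"
proof
  show "idempotents (PO_inf n) \<subseteq> carrier (PO_inf n)" by (auto simp: idempotents_def)
  show "\<one>\<^bsub>PO_inf n\<^esub> \<in> idempotents (PO_inf n)"
    by (auto simp: idempotents_PO_inf one_PO_inf)
  fix \<delta> \<epsilon> assume "\<delta> \<in> idempotents (PO_inf n)" "\<epsilon> \<in> idempotents (PO_inf n)"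
  then obtain A B where "\<delta> = Some |` A" "\<epsilon> = Some |` B"
    and "A \<subseteq> pos_tuples n" "finite (pos_tuples n - A)" "finite (pos_tuples n - B)"
    unfolding idempotents_PO_inf by blast
  then show "\<delta> \<otimes>\<^bsub>PO_inf n\<^esub> \<epsilon> \<in> idempotents (PO_inf n)"
    unfolding idempotents_PO_inf mult_PO_inf
    by (auto simp: comp_partial_identities Diff_Int intro!: exI[of _ "B \<inter> A"])
qed

lemma comm_monoid_idempotents_PO_inf:
  "comm_monoid ((PO_inf n)\<lparr>carrier := idempotents (PO_inf n)\<rparr>)"
proof (rule monoid.monoid_comm_monoidI)
  show "monoid ((PO_inf n)\<lparr>carrier := idempotents (PO_inf n)\<rparr>)"
    by (rule submonoid.submonoid_is_monoid[OF submonoid_idempotents_PO_inf monoid_PO_inf])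
qed (auto simp: idempotents_PO_inf mult_PO_inf comp_partial_identities Int_commute)

lemma iso_idempotents_PO_inf:
  "(\<lambda>\<epsilon>. pos_tuples n - dom \<epsilon>)
     \<in> iso ((PO_inf n)\<lparr>carrier := idempotents (PO_inf n)\<rparr>) (finite_subsets (pos_tuples n))"
proof (rule isoI)
  let ?E = "(PO_inf n)\<lparr>carrier := idempotents (PO_inf n)\<rparr>"
    and ?F = "finite_subsets (pos_tuples n)" and ?h = "\<lambda>\<epsilon>. pos_tuples n - dom \<epsilon>"
  show "?h \<in> hom ?E ?F"
  proof (rule homI)
    fix \<delta> \<epsilon> assume "\<delta> \<in> carrier ?E" "\<epsilon> \<in> carrier ?E"
    then obtain A B where "\<delta> = Some |` A" "\<epsilon> = Some |` B"
      by (auto simp: idempotents_PO_inf)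
    then show "?h (\<delta> \<otimes>\<^bsub>?E\<^esub> \<epsilon>) = ?h \<delta> \<otimes>\<^bsub>?F\<^esub> ?h \<epsilon>"
      by (simp add: mult_PO_inf comp_partial_identities dom_partial_identity finite_subsets_def
          Diff_Int Un_commute)
  qed (auto simp: idempotents_PO_inf finite_subsets_def Fpow_def dom_partial_identity)
  show "bij_betw ?h (carrier ?E) (carrier ?F)"
    by (rule bij_betw_byWitness[where f' = "\<lambda>C. Some |` (pos_tuples n - C)"])
      (auto simp: idempotents_PO_inf finite_subsets_def Fpow_def dom_partial_identity
        double_diff)
qed

theorem proposition3p3:
  fixes n :: nat
  assumes "n \<ge> 2"
  shows "submonoid (idempotents (PO_inf n)) (PO_inf n)
    \<and> comm_monoid ((PO_inf n)\<lparr>carrier := idempotents (PO_inf n)\<rparr>)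
    \<and> free_semilattice_with_unit TYPE('b) (pos_tuples n) (\<lambda>x. {x}) (finite_subsets (pos_tuples n))
    \<and> (\<lambda>\<epsilon>. pos_tuples n - dom \<epsilon>)
        \<in> iso ((PO_inf n)\<lparr>carrier := idempotents (PO_inf n)\<rparr>) (finite_subsets (pos_tuples n))"
  using submonoid_idempotents_PO_inf comm_monoid_idempotents_PO_inf
    free_semilattice_with_unit_finite_subsets iso_idempotents_PO_inf
  by (intro conjI)

end
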